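(* Let $f(X)=a_0+a_1X+\cdots+a_nX^n$ be a polynomial with integer coefficients, $M$ the maximum of the absolute values of its (complex) roots, and assume that for two integers $a,b$ we have $0<|f(a)|<|f(b)|$ and $\gcd(f(a),f'(a))=\gcd(f(b),f'(b))=1$. Let $$q_u=\max\left\{\frac{d_2}{d_1}\le\sqrt{\frac{|f(b)|}{|f(a)|}}\;:\; d_1\in\mathcal{D}_u(f(a)),\ d_2\in\mathcal{D}_u(f(b))\right\}.$$ Then: (i) If $|b|>q_u|a|+(1+q_u)M$, then $f$ is irreducible over $\mathbb{Q}$. (ii) If $|b|>\sqrt{q_u}\,|a|+(1+\sqrt{q_u})M$ and $f$ has no rational roots, then $f$ is irreducible over $\mathbb{Q}$. (iii) If $q_u=1$, $a^2<b^2$ and $M<\frac{|a+b|}{2}$, then $f$ is irreducible over $\mathbb{Q}$.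
   Context: Unitary divisors: for an integer $a$ with $f(a)\neq0$, an integer $d$ is a unitary divisor of $f(a)$ if $d\mid f(a)$ and $d$ is coprime with $f(a)/d$; the set of unitary divisors of $f(a)$ is denoted $\mathcal{D}_u(f(a))$. $f'$ is the derivative of $f$. *)

theory Defs
  imports Complex_Main "HOL-Computational_Algebra.Computational_Algebra"
begin

text \<open>Divisors of either sign are included; this is a divisor set only for \<open>m \<noteq> 0\<close>.\<close>

definition unitary_divisors :: "int \<Rightarrow> int set" where
  "unitary_divisors m = {d. d dvd m \<and> coprime d (m div d)}"

definition unitary_ratios :: "int \<Rightarrow> int \<Rightarrow> real set" where
  "unitary_ratios m n =
     {real_of_int d2 / real_of_int d1 | d1 d2.
        d1 \<in> unitary_divisors m \<and> d2 \<in> unitary_divisors n \<and>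
        real_of_int d2 / real_of_int d1 \<le> sqrt (real_of_int \<bar>n\<bar> / real_of_int \<bar>m\<bar>)}"

definition q_u :: "int poly \<Rightarrow> int \<Rightarrow> int \<Rightarrow> real" where
  "q_u f a b = Max (unitary_ratios (poly f a) (poly f b))"

definition max_root_abs :: "int poly \<Rightarrow> real" where
  "max_root_abs f = Max (cmod ` {z :: complex. poly (map_poly of_int f) z = 0})"

text \<open>The two maxima are taken over finite nonempty sets in the cases of interest, so
  \<^const>\<open>Max\<close> is meaningful.\<close>

lemma finite_unitary_divisors:
  assumes "m \<noteq> 0"
  shows "finite (unitary_divisors m)"
  by (rule finite_subset[of _ "{d. d dvd m}"]) (auto simp: unitary_divisors_def assms)

lemma finite_unitary_ratios:
  assumes "m \<noteq> 0" "n \<noteq> 0"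
  shows "finite (unitary_ratios m n)"
proof (rule finite_subset)
  show "unitary_ratios m n \<subseteq>
          (\<lambda>(d1, d2). real_of_int d2 / real_of_int d1) ` (unitary_divisors m \<times> unitary_divisors n)"
    by (auto simp: unitary_ratios_def)
  show "finite ((\<lambda>(d1, d2). real_of_int d2 / real_of_int d1) `
          (unitary_divisors m \<times> unitary_divisors n))"
    using assms by (intro finite_imageI finite_cartesian_product finite_unitary_divisors)
qed

lemma one_in_unitary_ratios:
  assumes "0 < \<bar>m\<bar>" "\<bar>m\<bar> \<le> \<bar>n\<bar>"
  shows "1 \<in> unitary_ratios m n"
proof -
  have "1 \<le> sqrt (real_of_int \<bar>n\<bar> / real_of_int \<bar>m\<bar>)"
    using assms by (simp add: le_divide_eq del: of_int_abs)
  then show ?thesis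
    unfolding unitary_ratios_def unitary_divisors_def
    by (intro CollectI exI[of _ "1::int"]) auto
qed

lemma finite_complex_roots:
  fixes f :: "int poly"
  assumes "f \<noteq> 0"
  shows "finite {z :: complex. poly (map_poly of_int f) z = 0}"
  using assms by (intro poly_roots_finite) (simp add: poly_eq_iff coeff_map_poly)

lemma complex_roots_nonempty:
  fixes f :: "int poly"
  assumes "degree f > 0"
  shows "{z :: complex. poly (map_poly of_int f) z = 0} \<noteq> {}"
proof -
  have "degree (map_poly of_int f :: complex poly) = degree f"
    by (rule degree_map_poly) auto
  then have "\<not> constant (poly (map_poly of_int f :: complex poly))"
    using assms by (simp add: constant_degree)
  from fundamental_theorem_of_algebra[OF this] show ?thesis by auto
qed

end

theory Submission
  imports Defs
begin

text \<open>A rational factorization of \<open>f\<close> descends to an integral one, \<open>f = g * h\<close>, by Gauss's lemma. A common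
  divisor of \<open>g(a)\<close> and \<open>h(a)\<close> divides both \<open>f(a)\<close> and \<open>f'(a)\<close>, so \<open>g(a)\<close> and \<open>h(a)\<close> are unitary divisors
  of \<open>f(a)\<close>, and likewise at \<open>b\<close>. Since the product of \<open>\<bar>g(b)/g(a)\<bar>\<close> and \<open>\<bar>h(b)/h(a)\<bar>\<close> is
  \<open>\<bar>f(b)/f(a)\<bar>\<close>, one of the two quotients is at most the square root of the latter, hence at most
  \<open>q\<^sub>u\<close>. On the other hand, each of the conditions (i)--(iii) makes \<open>\<bar>b - z\<bar> > r * \<bar>a - z\<bar>\<close> hold at every
  root \<open>z\<close> of \<open>f\<close>, with \<open>r\<close> equal to \<open>q\<^sub>u\<close>, \<open>sqrt q\<^sub>u\<close> and \<open>1\<close> respectively; multiplying over the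
  roots of the factor contradicts the upper bound. In case (ii) the factor has degree at least two,
  because \<open>f\<close> has no rational root.\<close>

section \<open>Integer polynomials over larger rings and Gauss's lemma\<close>

lemma map_poly_of_int_mult:
  fixes p q :: "int poly"
  shows "(map_poly of_int (p * q) :: 'a::comm_ring_1 poly) = map_poly of_int p * map_poly of_int q"
  by (rule poly_eqI) (simp add: coeff_map_poly coeff_mult)

lemma map_poly_of_int_smult:
  fixes p :: "int poly"
  shows "(map_poly of_int (smult c p) :: 'a::comm_ring_1 poly) = smult (of_int c) (map_poly of_int p)"
  by (rule poly_eqI) (simp add: coeff_map_poly)

lemma poly_map_poly_of_int:
  "poly (map_poly of_int p) (of_int x :: 'a::comm_ring_1) = of_int (poly p x)"
  by (induction p) (simp_all add: map_poly_pCons)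

lemma degree_map_poly_of_int:
  "degree (map_poly of_int p :: 'a::{comm_ring_1,ring_char_0} poly) = degree p"
  by (rule degree_map_poly) auto

lemma map_poly_of_int_inject:
  "(map_poly of_int p :: 'a::{comm_ring_1,ring_char_0} poly) = map_poly of_int q \<longleftrightarrow> p = q"
  by (auto simp: poly_eq_iff coeff_map_poly)

text \<open>Denominators are cleared one coefficient at a time, so \<open>c\<close> is simply a
  product of denominators.\<close>

lemma clear_denominators:
  fixes g :: "rat poly"
  obtains c G where "c \<noteq> 0" "smult (of_int c) g = map_poly of_int G"
proof -
  have "\<exists>c G. c \<noteq> 0 \<and> smult (of_int c) g = map_poly of_int G"
  proof (induction g)
    case 0
    show ?case by (intro exI[of _ 1] exI[of _ 0]) simp
  next
    case (pCons x g)
    then obtain c G where c: "c \<noteq> 0" "smult (of_int c) g = map_poly of_int G"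
      by blast
    obtain n d where x: "x = Rat.Fract n d" "d > 0"
      by (cases x rule: Rat_cases) auto
    have "smult (of_int (c * d)) (pCons x g)
            = map_poly of_int (pCons (n * c) (smult d G))"
      using x c by (simp add: map_poly_pCons map_poly_of_int_smult Fract_of_int_quotient mult.commute
          flip: c(2))
    moreover have "c * d \<noteq> 0"
      using c x by simp
    ultimately show ?case by blast
  qed
  then show thesis using that by blast
qed

text \<open>Clearing denominators gives \<open>c * d\<close> times \<open>f\<close> as
  \<open>G * H\<close> over the integers. Multiplicativity of the content lets \<open>c * d\<close>
  be cancelled, leaving a constant times the primitive parts of \<open>G\<close> and
  \<open>H\<close>.\<close>

lemma Gauss_factorization:
  fixes f :: "int poly" and g h :: "rat poly"
  assumes "f \<noteq> 0" and fgh: "map_poly of_int f = g * h"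
  obtains G H where "f = G * H" "degree G = degree g" "degree H = degree h"
proof -
  obtain c G where c: "c \<noteq> 0" "smult (of_int c) g = map_poly of_int G"
    by (rule clear_denominators)
  obtain d H where d: "d \<noteq> 0" "smult (of_int d) h = map_poly of_int H"
    by (rule clear_denominators)
  \<comment> \<open>The content is nonnegative, so the content of \<open>smult (c * d) f\<close> is
    \<open>\<bar>c * d\<bar> * content f\<close>; the sign in \<open>u\<close> turns this into
    \<open>c * d * u\<close>.\<close>
  define u where "u = sgn (c * d) * content f"
  have cd: "c * d \<noteq> 0"
    using c(1) d(1) by simp
  have "(map_poly of_int (smult (c * d) f) :: rat poly) = map_poly of_int (G * H)"
    unfolding map_poly_of_int_mult map_poly_of_int_smult fgh c(2)[symmetric] d(2)[symmetric]
    by (simp add: mult.commute)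
  then have eq: "smult (c * d) f = G * H"
    by (simp only: map_poly_of_int_inject)
  have "smult (c * d) f = smult (content G) (primitive_part G) * smult (content H) (primitive_part H)"
    by (simp only: eq content_times_primitive_part)
  also have "\<dots> = smult (content G * content H) (primitive_part G * primitive_part H)"
    by (simp only: mult_smult_left mult_smult_right smult_smult mult.commute[of "content G"])
  also have "content G * content H = content (smult (c * d) f)"
    by (simp only: eq content_mult)
  also have "\<dots> = (c * d) * u"
    by (simp add: u_def abs_sgn mult.assoc)
  finally have "smult (c * d) f = smult (c * d) (smult u (primitive_part G * primitive_part H))"
    by (simp only: smult_smult)
  with cd have "f = smult u (primitive_part G * primitive_part H)"
    by (rule smult_cancel)
  then have f: "f = smult u (primitive_part G) * primitive_part H"
    by (simp only: mult_smult_left)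
  have "u \<noteq> 0"
    using cd \<open>f \<noteq> 0\<close> by (simp add: u_def sgn_0_0)
  moreover have "degree G = degree g" "degree H = degree h"
    using arg_cong[OF c(2), of degree] arg_cong[OF d(2), of degree] c(1) d(1)
    by (simp_all add: degree_map_poly_of_int)
  ultimately show thesis
    by (intro that[OF f]) simp_all
qed

section \<open>Unitary divisors from factorizations\<close>

text \<open>Coprimality comes from the product rule. The absolute value makes later quotients
  positive; the sign moves to the cofactor, where it does not affect coprimality.\<close>

lemma factor_values_unitary:
  fixes g h :: "int poly"
  assumes nz: "poly (g * h) x \<noteq> 0"
    and gcd: "gcd (poly (g * h) x) (poly (pderiv (g * h)) x) = 1"
  shows "\<bar>poly g x\<bar> \<in> unitary_divisors (poly (g * h) x)"
proof -
  have "gcd (poly g x) (poly h x) dvd gcd (poly (g * h) x) (poly (pderiv (g * h)) x)"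
    by (intro gcd_greatest) (auto simp: pderiv_mult)
  then have coprime: "coprime (poly g x) (poly h x)"
    by (simp only: gcd is_unit_gcd)
  have g: "poly g x \<noteq> 0"
    using nz by simp
  have eq: "poly (g * h) x = \<bar>poly g x\<bar> * (sgn (poly g x) * poly h x)"
    by (simp add: abs_mult_sgn flip: mult.assoc)
  have "\<bar>poly g x\<bar> dvd poly (g * h) x"
    unfolding eq by (rule dvd_triv_left)
  moreover have "poly (g * h) x div \<bar>poly g x\<bar> = sgn (poly g x) * poly h x"
    unfolding eq by (rule nonzero_mult_div_cancel_left) (simp only: g abs_eq_0 not_False_eq_True)
  moreover have "coprime \<bar>poly g x\<bar> (sgn (poly g x) * poly h x)"
    using coprime g by (simp add: sgn_if)
  ultimately show ?thesis
    by (simp only: unitary_divisors_def mem_Collect_eq simp_thms)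
qed

lemma unitary_ratiosI:
  assumes "d1 \<in> unitary_divisors m" "d2 \<in> unitary_divisors n"
    and "real_of_int d2 / real_of_int d1 \<le> sqrt (real_of_int \<bar>n\<bar> / real_of_int \<bar>m\<bar>)"
  shows "real_of_int d2 / real_of_int d1 \<in> unitary_ratios m n"
  using assms unfolding unitary_ratios_def by blast

lemma q_u_upper:
  assumes "poly f a \<noteq> 0" "poly f b \<noteq> 0" "x \<in> unitary_ratios (poly f a) (poly f b)"
  shows "x \<le> q_u f a b"
  unfolding q_u_def using assms by (intro Max_ge finite_unitary_ratios)

lemma factor_value_le:
  fixes g h :: "int poly"
  assumes f: "f = g * h" and nz: "poly f a \<noteq> 0" "poly f b \<noteq> 0"
    and gcd: "gcd (poly f a) (poly (pderiv f) a) = 1" "gcd (poly f b) (poly (pderiv f) b) = 1"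
    and le: "real_of_int \<bar>poly g b\<bar> / real_of_int \<bar>poly g a\<bar>
               \<le> sqrt (real_of_int \<bar>poly f b\<bar> / real_of_int \<bar>poly f a\<bar>)"
  shows "real_of_int \<bar>poly g b\<bar> \<le> q_u f a b * real_of_int \<bar>poly g a\<bar>"
proof -
  have "\<bar>poly g a\<bar> \<in> unitary_divisors (poly f a)" "\<bar>poly g b\<bar> \<in> unitary_divisors (poly f b)"
    by (fact factor_values_unitary[of g h, folded f, OF nz(1) gcd(1)]
          factor_values_unitary[of g h, folded f, OF nz(2) gcd(2)])+
  then have "real_of_int \<bar>poly g b\<bar> / real_of_int \<bar>poly g a\<bar> \<in> unitary_ratios (poly f a) (poly f b)"
    using le by (rule unitary_ratiosI)
  note le = q_u_upper[OF nz this]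
  have "real_of_int \<bar>poly g a\<bar> > 0"
    using nz(1) by (simp add: f)
  with le show ?thesis
    by (simp only: pos_divide_le_eq)
qed

lemma le_of_mult_eq_square:
  fixes s x y :: "'a::linordered_idom"
  assumes "x * y = s * s" "0 \<le> s"
  shows "x \<le> s \<or> y \<le> s"
proof (rule ccontr)
  assume "\<not> ?thesis"
  with \<open>0 \<le> s\<close> have "s * s < x * y"
    by (intro mult_strict_mono') simp_all
  with assms(1) show False by simp
qed

lemma reducible_imp_small_factor:
  fixes f :: "int poly"
  assumes red: "\<not> irreducible (map_poly of_int f :: rat poly)" and deg: "degree f > 0"
    and nz: "poly f a \<noteq> 0" "poly f b \<noteq> 0"
    and gcd: "gcd (poly f a) (poly (pderiv f) a) = 1" "gcd (poly f b) (poly (pderiv f) b) = 1"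
  obtains g where "g dvd f" "degree g > 0" "real_of_int \<bar>poly g b\<bar> \<le> q_u f a b * real_of_int \<bar>poly g a\<bar>"
proof -
  let ?F = "map_poly of_int f :: rat poly"
  have degF: "degree ?F > 0"
    using deg by (simp add: degree_map_poly_of_int)
  then have "?F \<noteq> 0"
    by auto
  with degF have "\<not> is_unit ?F"
    by (simp add: is_unit_iff_degree)
  with red \<open>?F \<noteq> 0\<close> obtain g0 h0 where gh0: "?F = g0 * h0" "\<not> is_unit g0" "\<not> is_unit h0"
    by (auto simp: irreducible_def)
  obtain g h where f: "f = g * h" and "degree g = degree g0" "degree h = degree h0"
    using Gauss_factorization[OF _ gh0(1)] deg by (metis degree_0 less_irrefl)
  moreover have "g0 \<noteq> 0" "h0 \<noteq> 0"
    using gh0(1) \<open>?F \<noteq> 0\<close> by auto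
  ultimately have pos: "degree g > 0" "degree h > 0"
    using gh0(2,3) by (simp_all add: is_unit_iff_degree)
  let ?r = "\<lambda>p. real_of_int \<bar>poly p b\<bar> / real_of_int \<bar>poly p a\<bar>"
  have prod: "?r g * ?r h = sqrt (?r f) * sqrt (?r f)"
    by (simp add: f abs_mult)
  have "?r g \<le> sqrt (?r f) \<or> ?r h \<le> sqrt (?r f)"
    by (rule le_of_mult_eq_square[OF prod]) simp
  \<comment> \<open>\<open>f'\<close> is the swapped factorization, not the derivative; it allows
    \<open>h\<close> to take the role of \<open>g\<close>.\<close>
  moreover have f': "f = h * g"
    using f by (simp only: mult.commute)
  moreover have "g dvd f" "h dvd f"
    by (simp_all only: f dvd_triv_left dvd_triv_right)
  ultimately show thesis
    using factor_value_le[OF f nz gcd] factor_value_le[OF f' nz gcd] pos that by blast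
qed

section \<open>Comparing values through the complex roots\<close>

text \<open>Split \<open>p\<close> into linear factors and compare them one by one; the leading
  coefficient is common to both sides. Positive degree provides a factor, hence strictness.\<close>

lemma norm_poly_ratio_gt:
  fixes p :: "complex poly"
  assumes "degree p > 0" "r \<ge> 0"
    and gt: "\<And>z. poly p z = 0 \<Longrightarrow> cmod (y - z) > r * cmod (x - z)"
  shows "cmod (poly p y) > r ^ degree p * cmod (poly p x)"
proof -
  obtain root where root: "smult (lead_coeff p) (\<Prod>i<degree p. [:-root i, 1:]) = p"
    by (rule complex_poly_decompose')
  have ev: "cmod (poly p w) = cmod (lead_coeff p) * (\<Prod>i<degree p. cmod (w - root i))" for w
    by (subst root[symmetric]) (simp add: poly_prod norm_mult prod_norm[symmetric])
  have "poly p (root i) = 0" if "i < degree p" for i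
    by (subst root[symmetric]) (use that in \<open>auto simp: poly_prod\<close>)
  then have "r * cmod (x - root i) < cmod (y - root i)" if "i < degree p" for i
    using gt that by blast
  moreover have "0 \<le> r * cmod (x - root i)" for i
    using \<open>r \<ge> 0\<close> by simp
  ultimately have "(\<Prod>i<degree p. r * cmod (x - root i)) < (\<Prod>i<degree p. cmod (y - root i))"
    using assms(1)
    by (intro prod_mono_strict) (blast intro: less_imp_le le_less_trans | simp)+
  then have "r ^ degree p * (\<Prod>i<degree p. cmod (x - root i)) < (\<Prod>i<degree p. cmod (y - root i))"
    by (simp add: prod.distrib)
  moreover have "cmod (lead_coeff p) > 0"
    using assms(1) by auto
  ultimately show ?thesis
    unfolding ev by (simp add: mult.left_commute)
qed

lemma cmod_root_le_max_root_abs: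
  assumes "f \<noteq> 0" "poly (map_poly of_int f) (z :: complex) = 0"
  shows "cmod z \<le> max_root_abs f"
  unfolding max_root_abs_def using assms by (intro Max_ge finite_imageI finite_complex_roots imageI CollectI)

text \<open>Common core of the three criteria: a factor of degree \<open>k\<close> grows by more
  than \<open>r ^ k\<close> from \<open>a\<close> to \<open>b\<close>, so it suffices that
  \<open>r ^ k\<close> is at least \<open>q_u f a b\<close>.\<close>

lemma irreducible_if_roots_closer:
  fixes f :: "int poly" and r :: real
  assumes nz: "poly f a \<noteq> 0" "poly f b \<noteq> 0" and deg: "degree f > 0"
    and gcd: "gcd (poly f a) (poly (pderiv f) a) = 1" "gcd (poly f b) (poly (pderiv f) b) = 1"
    and gt: "\<And>z. poly (map_poly of_int f) z = 0 \<Longrightarrow> cmod (of_int b - z) > r * cmod (of_int a - z)"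
    and "r \<ge> 0"
    and pow: "\<And>g. g dvd f \<Longrightarrow> degree g > 0 \<Longrightarrow> q_u f a b \<le> r ^ degree g"
  shows "irreducible (map_poly of_int f :: rat poly)"
proof (rule ccontr)
  assume "\<not> ?thesis"
  then obtain g where g: "g dvd f" "degree g > 0"
      "real_of_int \<bar>poly g b\<bar> \<le> q_u f a b * real_of_int \<bar>poly g a\<bar>"
    by (rule reducible_imp_small_factor[OF _ deg nz gcd])
  let ?g = "map_poly of_int g :: complex poly"
  have "poly (map_poly of_int f) z = 0" if "poly ?g z = 0" for z
    using g(1) that by (auto elim!: dvdE simp: map_poly_of_int_mult)
  then have "cmod (poly ?g (of_int b)) > r ^ degree ?g * cmod (poly ?g (of_int a))"
    using g(2) \<open>r \<ge> 0\<close> gt by (intro norm_poly_ratio_gt) (simp_all only: degree_map_poly_of_int)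
  then have "real_of_int \<bar>poly g b\<bar> > r ^ degree g * real_of_int \<bar>poly g a\<bar>"
    by (simp add: poly_map_poly_of_int degree_map_poly_of_int)
  moreover have "q_u f a b * real_of_int \<bar>poly g a\<bar> \<le> r ^ degree g * real_of_int \<bar>poly g a\<bar>"
    using pow[OF g(1,2)] by (intro mult_right_mono) auto
  ultimately show False
    using g(3) by linarith
qed

section \<open>Locating the roots\<close>

lemma cmod_diff_gt_of_bound:
  assumes "cmod z \<le> M" "r \<ge> 0" "real_of_int \<bar>b\<bar> > r * real_of_int \<bar>a\<bar> + (1 + r) * M"
  shows "cmod (of_int b - z) > r * cmod (of_int a - z)"
proof -
  have "r * cmod (of_int a - z) \<le> r * (real_of_int \<bar>a\<bar> + M)"
    using assms(1,2) norm_triangle_ineq4[of "of_int a" z] by (intro mult_left_mono) auto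
  also have "\<dots> < real_of_int \<bar>b\<bar> - M"
    using assms(3) by (simp add: algebra_simps)
  also have "\<dots> \<le> cmod (of_int b - z)"
    using assms(1) norm_triangle_ineq2[of "of_int b" z] by simp
  finally show ?thesis .
qed

lemma mult_diff_pos:
  fixes c d x :: "'a::linordered_idom"
  assumes "d * c > 0" "\<bar>x\<bar> < \<bar>c\<bar>"
  shows "d * (c - x) > 0"
  using assms by (auto simp: zero_less_mult_iff)

text \<open>The difference of the squared distances is \<open>(b - a) * (b + a - 2 * Re z)\<close>.
  Since \<open>\<bar>2 * Re z\<bar> < \<bar>a + b\<bar>\<close>, it has the sign of
  \<open>(b - a) * (b + a)\<close>.\<close>

lemma cmod_diff_gt_of_midpoint:
  assumes "cmod z \<le> M" "a\<^sup>2 < b\<^sup>2" "M < real_of_int \<bar>a + b\<bar> / 2"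
  shows "cmod (of_int b - z) > cmod (of_int a - z)"
proof -
  have "0 < (b - a) * (b + a)"
    using assms(2) by (simp add: power2_eq_square algebra_simps)
  then have "real_of_int (b - a) * real_of_int (b + a) > 0"
    by (simp only: of_int_0_less_iff flip: of_int_mult)
  moreover have "\<bar>2 * Re z\<bar> < \<bar>real_of_int (b + a)\<bar>"
    using assms(1,3) abs_Re_le_cmod[of z] by (simp add: abs_mult add.commute)
  ultimately have "real_of_int (b - a) * (real_of_int (b + a) - 2 * Re z) > 0"
    by (rule mult_diff_pos)
  then have "(cmod (of_int a - z))\<^sup>2 < (cmod (of_int b - z))\<^sup>2"
    unfolding cmod_power2 by (simp add: power2_eq_square algebra_simps)
  then show ?thesis
    by (rule power2_less_imp_less) simp
qed

lemma degree_1_imp_rational_root: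
  fixes f g :: "int poly"
  assumes "g dvd f" "degree g = 1"
  shows "\<exists>x :: rat. poly (map_poly of_int f) x = 0"
proof -
  obtain c d where g: "g = [:c, d:]" "d \<noteq> 0"
    using assms(2) by (rule degree1_coeffs)
  then have "poly (map_poly of_int g) (- of_int c / of_int d :: rat) = 0"
    by (simp add: map_poly_pCons)
  then show ?thesis
    using assms(1) by (auto elim!: dvdE simp: map_poly_of_int_mult)
qed

theorem theorem3p2:
  fixes f :: "int poly" and a b :: int and M q :: real
  assumes "0 < \<bar>poly f a\<bar>"
    and "\<bar>poly f a\<bar> < \<bar>poly f b\<bar>"
    and "gcd (poly f a) (poly (pderiv f) a) = 1"
    and "gcd (poly f b) (poly (pderiv f) b) = 1"
    and "M = max_root_abs f"
    and "q = q_u f a b"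
  shows "(real_of_int \<bar>b\<bar> > q * real_of_int \<bar>a\<bar> + (1 + q) * M
            \<longrightarrow> irreducible (map_poly of_int f :: rat poly))
       \<and> (real_of_int \<bar>b\<bar> > sqrt q * real_of_int \<bar>a\<bar> + (1 + sqrt q) * M
            \<and> (\<forall>x :: rat. poly (map_poly of_int f) x \<noteq> 0)
            \<longrightarrow> irreducible (map_poly of_int f :: rat poly))
       \<and> (q = 1 \<and> a\<^sup>2 < b\<^sup>2 \<and> M < real_of_int \<bar>a + b\<bar> / 2
            \<longrightarrow> irreducible (map_poly of_int f :: rat poly))"
proof (intro conjI impI; (elim conjE)?)
  have nz: "poly f a \<noteq> 0" "poly f b \<noteq> 0"
    using assms(1,2) by linarith+
  \<comment> \<open>A constant polynomial would have equal values at \<open>a\<close> and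
    \<open>b\<close>.\<close>
  have deg: "degree f > 0"
    using assms(2) by (auto intro!: Nat.gr0I elim!: degree_eq_zeroE)
  have M: "cmod z \<le> M" if "poly (map_poly of_int f) z = 0" for z
    using cmod_root_le_max_root_abs[OF _ that] deg unfolding assms(5) by force
  \<comment> \<open>The ratio 1, from \<open>d1 = d2 = 1\<close>, is admissible. This bound makes
    powers of \<open>q\<close> and \<open>sqrt q\<close> increase with the exponent.\<close>
  have q1: "q \<ge> 1"
    unfolding assms(6) by (intro q_u_upper[OF nz] one_in_unitary_ratios assms(1) less_imp_le[OF assms(2)])
  note irr = irreducible_if_roots_closer[OF nz deg assms(3,4), folded assms(6)]
  show "irreducible (map_poly of_int f :: rat poly)"
    if gt: "real_of_int \<bar>b\<bar> > q * real_of_int \<bar>a\<bar> + (1 + q) * M"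
  proof (rule irr[of q])
    show "cmod (of_int b - z) > q * cmod (of_int a - z)" if "poly (map_poly of_int f) z = 0" for z
      using q1 by (intro cmod_diff_gt_of_bound[OF M[OF that] _ gt]) simp
    show "q \<le> q ^ degree g" if "degree g > 0" for g :: "int poly"
      using q1 that by (simp add: self_le_power)
  qed (use q1 in simp)
  show "irreducible (map_poly of_int f :: rat poly)"
    if gt: "real_of_int \<bar>b\<bar> > sqrt q * real_of_int \<bar>a\<bar> + (1 + sqrt q) * M"
      and no_root: "\<forall>x :: rat. poly (map_poly of_int f) x \<noteq> 0"
  proof (rule irr[of "sqrt q"])
    show "cmod (of_int b - z) > sqrt q * cmod (of_int a - z)" if "poly (map_poly of_int f) z = 0" for z
      using q1 by (intro cmod_diff_gt_of_bound[OF M[OF that] _ gt]) simp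
    show "q \<le> sqrt q ^ degree g" if "g dvd f" "degree g > 0" for g
    proof -
      have "degree g \<noteq> 1"
        using degree_1_imp_rational_root[OF that(1)] no_root by blast
      \<comment> \<open>Exponent 2 is exactly what recovers \<open>q\<close> from
        \<open>sqrt q\<close>; linear factors are excluded by the absence of rational roots.\<close>
      with that(2) have "sqrt q ^ 2 \<le> sqrt q ^ degree g"
        using q1 by (intro power_increasing) auto
      then show ?thesis
        using q1 by simp
    qed
  qed (use q1 in simp)
  show "irreducible (map_poly of_int f :: rat poly)"
    if "q = 1" "a\<^sup>2 < b\<^sup>2" "M < real_of_int \<bar>a + b\<bar> / 2"
    \<comment> \<open>With \<open>q = 1\<close> every power of \<open>r = 1\<close> meets the degree
      condition.\<close>
    using cmod_diff_gt_of_midpoint[OF M that(2,3)] that(1) by (intro irr[of 1]) simp_all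
qed

end
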